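(* In the setting described in the context, assume that the augmenting function $\sigma$ has the following property: if $\{w_k\}\subset H$ and $\sigma(w_k)\downarrow 0$ (that is, $\sigma(w_k)$ decreases to $0$), then $\{w_k\}$ is bounded. Assume also that $M_P=M_D$. Consider the primal sequence $\{x_k\}$ generated by DSG-1, with the parameter sequence $\{\alpha_k\}$ satisfying $\alpha_k\ge\bar\alpha$ for all $k$ and some $\bar\alpha>0$. Then $\{x_k\}$ is bounded, all its weak accumulation points are primal solutions (i.e. belong to $S(P)$), and $\{q_k\}$, where $q_k:=q(y_k,c_k)$, converges to the optimal value $M_P$.
   Context: Setting. $X$ is a reflexive Banach space, $H$ a Hilbert space, $\mathbb{R}_+=[0,\infty)$. A set is weakly compact if its weak closure is compact in the weak topology. An extended-real function is w-lsc (weakly lower semicontinuous) if its epigraph is weakly closed, and w-usc if its negative is w-lsc. A function is proper if it never takes the value $-\infty$ and is not identically $+\infty$. $\varphi:X\to\mathbb{R}\cup\{+\infty\}$ is proper, w-lsc, and its level sets $\{x:\varphi(x)\le a\}$, $a\in\mathbb{R}$, are weakly compact. $M_P=\inf_X\varphi$, and $S(P)$ is the set of minimizers of $\varphi$. $f:X\times H\to[-\infty,+\infty]$ satisfies $f(x,0)=\varphi(x)$ for all $x\in X$, is proper, w-lsc and weakly level-compact: for each $\bar z\in H$ and $a\in\mathbb{R}$ there are a weakly open neighbourhood $U$ of $\bar z$ and a weakly compact $B\subset X$ with $\{x:f(x,z)\le a\}\subset B$ for all $z\in U$. $\sigma:H\to\mathbb{R}\cup\{+\infty\}$ is an augmenting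 function: it is proper, w-lsc, $\sigma(0)=0$, $\mathrm{argmin}\,\sigma=\{0\}$, and it is either coercive ($\sigma(z)\to+\infty$ as $\|z\|\to\infty$) or conditionally coercive (there is $K_\sigma>0$ such that $\{z:\sigma(z)\le K_\sigma\}$ is bounded). $A:H\to H$ satisfies $\|A(z)\|\le\sigma(z)$ for all $z\in H$, and $z\mapsto\langle A(z),y\rangle$ is w-usc for every $y\in H$. The dual function is $q(y,c)=\inf_{x\in X}\inf_{z\in H}\{f(x,z)-\langle A(z),y\rangle+c\sigma(z)\}$ for $(y,c)\in H\times\mathbb{R}_+$, and $M_D=\sup_{H\times\mathbb{R}_+}q$. It is assumed that $q(\bar y,\bar c)>-\infty$ for some $(\bar y,\bar c)\in H\times\mathbb{R}_+$. For $r\ge0$, $X_r(y,c)=\{(x,z)\in X\times H: f(x,z)-\langle A(z),y\rangle+c\sigma(z)\le q(y,c)+r\}$. Algorithm DSG. Step 0: choose $(y_0,c_0)\in H\times\mathbb{R}_+$ with $q(y_0,c_0)>-\infty$, $\epsilon>0$, $\delta<1$, $\{\alpha_k\}\subset(0,\alpha)$ for some $\alpha>0$, and $\{r_k\}\subset\mathbb{R}_+$ with $r_k\to0$; let $k:=0$. Step 1: (a) find $(x_k,z_k)\in X_{r_k}(y_k,c_k)$; (b) if $z_k=0$ and $r_k\le\epsilon$, stop; (c) if $z_k=0$ and $r_k>\epsilon$, set $r_k:=\delta r_k$ and go to (a); (d) if $z_k\ne0$ go to Step 2. Step 2: take a stepsize $s_k>0$, set $y_{k+1}=y_k-s_kA(z_k)$,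 $c_{k+1}=c_k+(\alpha_k+1)s_k\sigma(z_k)$, $k:=k+1$, and go to Step 1. DSG-1 is DSG with stepsizes $s_k\in[\eta_k,\beta_k]$, where $\eta_k=\min\{\eta,\|A(z_k)\|+\|z_k\|\}$, $\beta_k=\max\{\beta,\sigma(z_k)+\|z_k\|\}$, and $\beta>\eta>0$ are fixed parameters. Standing assumptions on the run of the algorithm. It is assumed that $z_k\neq0$ for all $k$, so the method generates infinite sequences. The initial iterate and parameters are assumed to be chosen as follows, where $(\hat y,\hat c)\in H\times\mathbb{R}_+$ satisfies $q(\hat y,\hat c)>-\infty$ and $\tilde r$ is an upper bound of $\{r_k\}$. If $\sigma$ is coercive: $y_0=\hat y$ and $c_0>\hat c$. If $\sigma$ is conditionally coercive with constant $K_\sigma$: $y_0=\hat y$, $c_0>\hat c+\frac{s-q(\hat y,\hat c)}{K_\sigma}$ for some $s\ge M_P$, and $\alpha_0s_0>\frac{M_P-q(y_0,c_0)+\tilde r}{K_\sigma\,\sigma(z_0)}$. (A coercive $\sigma$ is also conditionally coercive; for such $\sigma$ the first, weaker choice suffices.) *)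

theory Defs
  imports "HOL-Analysis.Analysis"
begin

section \<open>Weak topology and reflexivity\<close>

definition weak_topology :: "'a::real_normed_vector topology" where
  "weak_topology =
     topology_generated_by {blinfun_apply g -` U | (g :: 'a \<Rightarrow>\<^sub>L real) U. open U}"

definition reflexive_space :: "'a::real_normed_vector itself \<Rightarrow> bool" where
  "reflexive_space _ \<longleftrightarrow>
     (\<forall>F :: ('a \<Rightarrow>\<^sub>L real) \<Rightarrow>\<^sub>L real. \<exists>x::'a. \<forall>g. blinfun_apply F g = blinfun_apply g x)"

definition weakly_compact :: "'a::real_normed_vector set \<Rightarrow> bool" where
  "weakly_compact S \<longleftrightarrow> compactin weak_topology (weak_topology closure_of S)"

text \<open>Accumulation points of a sequence are its topological cluster points; every limit of a
  weakly convergent subsequence is one.\<close>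

definition weak_accumulation_point :: "(nat \<Rightarrow> 'a::real_normed_vector) \<Rightarrow> 'a \<Rightarrow> bool" where
  "weak_accumulation_point x p \<longleftrightarrow>
     (\<forall>U. openin weak_topology U \<and> p \<in> U \<longrightarrow> (\<exists>\<^sub>F k in sequentially. x k \<in> U))"

section \<open>Extended real valued functions\<close>

definition proper :: "('a \<Rightarrow> ereal) \<Rightarrow> bool" where
  "proper g \<longleftrightarrow> (\<forall>x. g x \<noteq> -\<infinity>) \<and> (\<exists>x. g x \<noteq> \<infinity>)"

definition minimizers :: "('a \<Rightarrow> ereal) \<Rightarrow> 'a set" where
  "minimizers g = {x. \<forall>u. g x \<le> g u}"

definition w_lsc :: "('a::real_normed_vector \<Rightarrow> ereal) \<Rightarrow> bool" where
  "w_lsc g \<longleftrightarrow> closedin weak_topology {(x, t::real). g x \<le> ereal t}"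

definition w_usc :: "('a::real_normed_vector \<Rightarrow> ereal) \<Rightarrow> bool" where
  "w_usc g \<longleftrightarrow> w_lsc (\<lambda>x. - g x)"

definition weakly_level_compact ::
    "('a::real_normed_vector \<times> 'h::real_normed_vector \<Rightarrow> ereal) \<Rightarrow> bool" where
  "weakly_level_compact f \<longleftrightarrow>
     (\<forall>zbar (a::real). \<exists>U B. openin weak_topology U \<and> zbar \<in> U \<and> weakly_compact B \<and>
        (\<forall>z\<in>U. {x. f (x, z) \<le> ereal a} \<subseteq> B))"

section \<open>Augmenting functions\<close>

definition coercive :: "('h::real_normed_vector \<Rightarrow> ereal) \<Rightarrow> bool" where
  "coercive \<sigma> \<longleftrightarrow> (\<sigma> \<longlongrightarrow> \<infinity>) at_infinity"

definition conditionally_coercive_with :: "real \<Rightarrow> ('h::real_normed_vector \<Rightarrow> ereal) \<Rightarrow> bool" where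
  "conditionally_coercive_with K \<sigma> \<longleftrightarrow> 0 < K \<and> bounded {z. \<sigma> z \<le> ereal K}"

definition augmenting :: "('h::real_normed_vector \<Rightarrow> ereal) \<Rightarrow> bool" where
  "augmenting \<sigma> \<longleftrightarrow> proper \<sigma> \<and> w_lsc \<sigma> \<and> \<sigma> 0 = 0 \<and> minimizers \<sigma> = {0} \<and>
     (coercive \<sigma> \<or> (\<exists>K. conditionally_coercive_with K \<sigma>))"

section \<open>Augmented Lagrangian duality\<close>

text \<open>For \<open>c = 0\<close> and \<open>\<sigma> z = \<infinity>\<close> the product \<open>c * \<sigma> z\<close> is \<open>0\<close>, the usual convention of
  convex analysis. No other indeterminate expression occurs when \<open>f\<close> and \<open>\<sigma>\<close> are proper and
  \<open>c \<ge> 0\<close>.\<close>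

definition augmented_objective ::
    "('a \<times> 'h::real_inner \<Rightarrow> ereal) \<Rightarrow> ('h \<Rightarrow> 'h) \<Rightarrow> ('h \<Rightarrow> ereal) \<Rightarrow> 'h \<Rightarrow> real \<Rightarrow> 'a \<Rightarrow> 'h \<Rightarrow> ereal" where
  "augmented_objective f A \<sigma> y c x z = f (x, z) - ereal (A z \<bullet> y) + ereal c * \<sigma> z"

definition dual_function ::
    "('a \<times> 'h::real_inner \<Rightarrow> ereal) \<Rightarrow> ('h \<Rightarrow> 'h) \<Rightarrow> ('h \<Rightarrow> ereal) \<Rightarrow> 'h \<Rightarrow> real \<Rightarrow> ereal" where
  "dual_function f A \<sigma> y c = (INF x. INF z. augmented_objective f A \<sigma> y c x z)"

definition primal_value :: "('a \<Rightarrow> ereal) \<Rightarrow> ereal" where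
  "primal_value \<phi> = (INF x. \<phi> x)"

definition dual_value ::
    "('a \<times> 'h::real_inner \<Rightarrow> ereal) \<Rightarrow> ('h \<Rightarrow> 'h) \<Rightarrow> ('h \<Rightarrow> ereal) \<Rightarrow> ereal" where
  "dual_value f A \<sigma> = (SUP (y, c) \<in> UNIV \<times> {0..}. dual_function f A \<sigma> y c)"

definition near_minimizers ::
    "('a \<times> 'h::real_inner \<Rightarrow> ereal) \<Rightarrow> ('h \<Rightarrow> 'h) \<Rightarrow> ('h \<Rightarrow> ereal) \<Rightarrow> real \<Rightarrow> 'h \<Rightarrow> real \<Rightarrow> ('a \<times> 'h) set"
  where
  "near_minimizers f A \<sigma> r y c =
     {(x, z). augmented_objective f A \<sigma> y c x z \<le> dual_function f A \<sigma> y c + ereal r}"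

section \<open>The deflected subgradient method\<close>

text \<open>\<open>dsg_search f A \<sigma> \<epsilon> \<delta> y c r x z\<close>: Step 1 at the dual iterate \<open>(y, c)\<close>, entered with tolerance
  \<open>r\<close>, can be left with the pair \<open>(x, z)\<close>, after finitely many reductions of the tolerance by the
  factor \<open>\<delta>\<close>. The method stops there if \<open>z = 0\<close> and goes on to Step 2 if \<open>z \<noteq> 0\<close>.\<close>

inductive dsg_search ::
    "('a \<times> 'h::real_inner \<Rightarrow> ereal) \<Rightarrow> ('h \<Rightarrow> 'h) \<Rightarrow> ('h \<Rightarrow> ereal) \<Rightarrow> real \<Rightarrow> real \<Rightarrow> 'h \<Rightarrow> real
      \<Rightarrow> real \<Rightarrow> 'a \<Rightarrow> 'h \<Rightarrow> bool"
  for f A \<sigma> \<epsilon> \<delta> y c where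
  leave: "(x, z) \<in> near_minimizers f A \<sigma> r y c \<Longrightarrow> z \<noteq> 0 \<or> r \<le> \<epsilon> \<Longrightarrow> dsg_search f A \<sigma> \<epsilon> \<delta> y c r x z"
| retry: "(x', 0) \<in> near_minimizers f A \<sigma> r y c \<Longrightarrow> r > \<epsilon> \<Longrightarrow> dsg_search f A \<sigma> \<epsilon> \<delta> y c (\<delta> * r) x z
    \<Longrightarrow> dsg_search f A \<sigma> \<epsilon> \<delta> y c r x z"

text \<open>An infinite run; \<open>r\<close> is the tolerance sequence chosen at the start, before any reduction in
  Step 1. The update of \<open>c\<close> is stated in the extended reals, so it includes the finiteness of
  \<open>\<sigma> (z k)\<close>, which holds automatically when \<open>c k > 0\<close>.\<close>

definition dsg_run ::
    "('a \<times> 'h::real_inner \<Rightarrow> ereal) \<Rightarrow> ('h \<Rightarrow> 'h) \<Rightarrow> ('h \<Rightarrow> ereal) \<Rightarrow> real \<Rightarrow> real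
      \<Rightarrow> (nat \<Rightarrow> real) \<Rightarrow> (nat \<Rightarrow> real) \<Rightarrow> (nat \<Rightarrow> real)
      \<Rightarrow> (nat \<Rightarrow> 'a) \<Rightarrow> (nat \<Rightarrow> 'h) \<Rightarrow> (nat \<Rightarrow> 'h) \<Rightarrow> (nat \<Rightarrow> real) \<Rightarrow> bool" where
  "dsg_run f A \<sigma> \<epsilon> \<delta> \<alpha> r s x z y c \<longleftrightarrow>
     c 0 \<ge> 0 \<and> dual_function f A \<sigma> (y 0) (c 0) > -\<infinity> \<and> \<epsilon> > 0 \<and> \<delta> < 1 \<and>
     (\<exists>\<alpha>max>0. \<forall>k. 0 < \<alpha> k \<and> \<alpha> k < \<alpha>max) \<and>
     (\<forall>k. r k \<ge> 0) \<and> r \<longlonglongrightarrow> 0 \<and>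
     (\<forall>k. dsg_search f A \<sigma> \<epsilon> \<delta> (y k) (c k) (r k) (x k) (z k)) \<and>
     (\<forall>k. z k \<noteq> 0) \<and>
     (\<forall>k. s k > 0) \<and>
     (\<forall>k. y (Suc k) = y k - s k *\<^sub>R A (z k)) \<and>
     (\<forall>k. ereal (c (Suc k)) = ereal (c k) + ereal ((\<alpha> k + 1) * s k) * \<sigma> (z k))"

definition dsg1_stepsizes ::
    "('h::real_inner \<Rightarrow> 'h) \<Rightarrow> ('h \<Rightarrow> ereal) \<Rightarrow> real \<Rightarrow> real \<Rightarrow> (nat \<Rightarrow> 'h) \<Rightarrow> (nat \<Rightarrow> real) \<Rightarrow> bool" where
  "dsg1_stepsizes A \<sigma> \<eta> \<beta> z s \<longleftrightarrow> \<beta> > \<eta> \<and> \<eta> > 0 \<and>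
     (\<forall>k. min \<eta> (norm (A (z k)) + norm (z k)) \<le> s k \<and>
          ereal (s k) \<le> max (ereal \<beta>) (\<sigma> (z k) + ereal (norm (z k))))"

definition dsg1_run ::
    "('a \<times> 'h::real_inner \<Rightarrow> ereal) \<Rightarrow> ('h \<Rightarrow> 'h) \<Rightarrow> ('h \<Rightarrow> ereal) \<Rightarrow> real \<Rightarrow> real \<Rightarrow> real \<Rightarrow> real
      \<Rightarrow> (nat \<Rightarrow> real) \<Rightarrow> (nat \<Rightarrow> real) \<Rightarrow> (nat \<Rightarrow> real)
      \<Rightarrow> (nat \<Rightarrow> 'a) \<Rightarrow> (nat \<Rightarrow> 'h) \<Rightarrow> (nat \<Rightarrow> 'h) \<Rightarrow> (nat \<Rightarrow> real) \<Rightarrow> bool" where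
  "dsg1_run f A \<sigma> \<eta> \<beta> \<epsilon> \<delta> \<alpha> r s x z y c \<longleftrightarrow>
     dsg_run f A \<sigma> \<epsilon> \<delta> \<alpha> r s x z y c \<and> dsg1_stepsizes A \<sigma> \<eta> \<beta> z s"

end

theory Submission
  imports Defs
begin

text \<open>
  Since \<open>\<parallel>A z\<parallel> \<le> \<sigma> z\<close>, the excess of the growth of \<open>c k\<close> over the displacement of \<open>y k\<close> is at
  least \<open>D k = (\<Sum>j<k. \<alpha> j * s j * \<sigma> (z j))\<close>, so that near-optimality of \<open>(x k, z k)\<close> bounds
  \<open>(c 0 - chat + D k) * \<sigma> (z k)\<close> by a constant. This bounds \<open>\<sigma> (z k)\<close> and, by (conditional)
  coercivity, \<open>z k\<close>. If \<open>D\<close> is unbounded then \<open>\<sigma> (z k) \<rightarrow> 0\<close>; otherwise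
  \<open>s k * \<sigma> (z k)\<close> is summable, and the lower bound on the stepsizes forces \<open>\<sigma> (z k)\<close> to be small
  whenever \<open>z k\<close> is not. As \<open>0\<close> is the only minimizer of the weakly lower semicontinuous \<open>\<sigma>\<close>, in both
  cases \<open>z k\<close> tends weakly to \<open>0\<close>. The terms \<open>A (z k) \<bullet> y k - c k * \<sigma> (z k)\<close> are
  asymptotically nonpositive, hence \<open>f (x k, z k) \<le> q k + o(1)\<close> with \<open>q k \<le> primal_value \<phi>\<close> by weak
  duality. Level compactness places \<open>x k\<close> in a weakly compact set, and semicontinuity of \<open>f\<close> at
  \<open>(p, 0)\<close> shows that a cluster point \<open>p\<close> has \<open>\<phi> p \<le> primal_value \<phi>\<close>, and that \<open>q k\<close> cannot
  stay below \<open>primal_value \<phi>\<close> along a subsequence.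

  Weak topologies need not be metrizable, so cluster points are reached along subfilters
  of \<open>sequentially\<close> rather than subsequences.
\<close>

section \<open>Norming functionals\<close>

text \<open>Homogeneity is asked only as an inequality for positive factors, so that a pointwise
  infimum needs a single estimate; inverting the factor recovers equality.\<close>

definition sublinear :: "('a::real_vector \<Rightarrow> real) \<Rightarrow> bool" where
  "sublinear p \<longleftrightarrow> (\<forall>u v. p (u + v) \<le> p u + p v) \<and> (\<forall>t>0. \<forall>u. p (t *\<^sub>R u) \<le> t * p u)"

lemma sublinear_zero:
  assumes "sublinear p" shows "p 0 = 0"
proof -
  have s: "p 0 \<le> t * p 0" if "t > 0" for t
    using assms that unfolding sublinear_def by (metis scale_zero_right)
  from s[of 2] s[of "1/2"] show ?thesis by simp
qed

lemma sublinear_scale: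
  assumes "sublinear p" "t \<ge> 0" shows "p (t *\<^sub>R u) = t * p u"
proof (cases "t = 0")
  case False
  then have t: "t > 0" using assms(2) by simp
  have "p ((1/t) *\<^sub>R (t *\<^sub>R u)) \<le> (1/t) * p (t *\<^sub>R u)"
    using assms(1) t unfolding sublinear_def by (meson divide_pos_pos zero_less_one)
  then have "t * p u \<le> p (t *\<^sub>R u)" using t by (simp add: field_simps)
  moreover have "p (t *\<^sub>R u) \<le> t * p u" using assms(1) t unfolding sublinear_def by blast
  ultimately show ?thesis by simp
qed (simp add: sublinear_zero[OF assms(1)])

lemma sublinear_minus:
  assumes "sublinear p" shows "- p (- u) \<le> p u"
proof -
  have "p (u + - u) \<le> p u + p (- u)" using assms unfolding sublinear_def by blast
  then show ?thesis using sublinear_zero[OF assms] by simp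
qed

text \<open>The witness is the infimum of \<open>p (u + t *\<^sub>R y) - t * p y\<close> over
  \<open>t \<ge> 0\<close>; the choices \<open>t = 0\<close> and \<open>t = 1\<close> give the two
  bounds. It serves both to make minimal functionals additive and to make a functional attain the
  norm.\<close>

lemma sublinear_shift:
  fixes y :: "'a::real_vector"
  assumes p: "sublinear p"
  obtains q where "sublinear q" "\<And>u. q u \<le> p u" "\<And>u. q u \<le> p (u + y) - p y"
proof
  define q where "q u = (INF t\<in>{0::real..}. p (u + t *\<^sub>R y) - t * p y)" for u
  have sub: "p (u + v) \<le> p u + p v" for u v using p unfolding sublinear_def by blast
  \<comment> \<open>Subadditivity bounds every competitor below by a quantity free of
    \<open>t\<close>, so the infimum is over a set bounded below.\<close>
  have low: "- p (- u) \<le> p (u + t *\<^sub>R y) - t * p y" if "t \<ge> 0" for t u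
    using sub[of "u + t *\<^sub>R y" "- u"] sublinear_scale[OF p that, of y] by simp
  have bdd: "bdd_below ((\<lambda>t. p (u + t *\<^sub>R y) - t * p y) ` {0..})" for u
    using low by (intro bdd_belowI2[of _ "- p (- u)"]) auto
  have up: "q u \<le> p (u + t *\<^sub>R y) - t * p y" if "t \<ge> 0" for t u
    unfolding q_def by (rule cINF_lower[OF bdd]) (use that in auto)
  have greatest: "l \<le> q u" if "\<And>t. t \<ge> 0 \<Longrightarrow> l \<le> p (u + t *\<^sub>R y) - t * p y" for l u
    unfolding q_def by (rule cINF_greatest) (use that in auto)
  show "q u \<le> p u" for u using up[of 0 u] by simp
  show "q u \<le> p (u + y) - p y" for u using up[of 1 u] by simp
  show "sublinear q" unfolding sublinear_def
  proof (intro conjI allI impI)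
    fix u v
    \<comment> \<open>Shifts add up: \<open>t + s\<close> is a competitor for
      \<open>u + v\<close>.\<close>
    have "q (u + v) \<le> (p (u + t *\<^sub>R y) - t * p y) + (p (v + s *\<^sub>R y) - s * p y)"
      if "t \<ge> 0" "s \<ge> 0" for t s
      using up[of "t + s" "u + v"] sub[of "u + t *\<^sub>R y" "v + s *\<^sub>R y"] that
      by (simp add: algebra_simps)
    then have "q (u + v) - (p (v + s *\<^sub>R y) - s * p y) \<le> q u" if "s \<ge> 0" for s
      using that by (intro greatest) (simp add: algebra_simps)
    then have "q (u + v) - q u \<le> q v" by (intro greatest) (simp add: algebra_simps)
    then show "q (u + v) \<le> q u + q v" by simp
  next
    fix t :: real and u assume t: "t > 0"
    have "q (t *\<^sub>R u) / t \<le> p (u + s *\<^sub>R y) - s * p y" if "s \<ge> 0" for s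
    proof -
      have "q (t *\<^sub>R u) \<le> t * p (u + s *\<^sub>R y) - t * s * p y"
        using up[of "t * s" "t *\<^sub>R u"] sublinear_scale[OF p, of t "u + s *\<^sub>R y"] t that
        by (simp add: scaleR_add_right)
      then show ?thesis using t by (simp add: field_simps)
    qed
    then have "q (t *\<^sub>R u) / t \<le> q u" by (intro greatest)
    then show "q (t *\<^sub>R u) \<le> t * q u" using t by (simp add: field_simps)
  qed
qed

text \<open>Hahn--Banach through Zorn's lemma on the sublinear functionals below \<open>p\<close>: a minimal one is
  not decreased by \<open>sublinear_shift\<close>, which makes it additive.\<close>

theorem sublinear_dominates_linear:
  fixes p :: "'a::real_vector \<Rightarrow> real"
  assumes p: "sublinear p"
  obtains g where "linear g" "\<And>u. g u \<le> p u"
proof -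
  define S where "S = {m. sublinear m \<and> m \<le> p}"
  have "\<exists>m\<in>S. \<forall>a\<in>S. a \<le> m \<longrightarrow> a = m"
  proof (rule predicate_Zorn)
    \<comment> \<open>The order is reversed, so that the bound which Zorn's lemma asks of a chain is
      a lower one.\<close>
    show "partial_order_on S (relation_of (\<lambda>a b. b \<le> a) S)"
      by (rule partial_order_on_relation_ofI) auto
  next
    fix C assume C: "C \<in> Chains (relation_of (\<lambda>a b. b \<le> a) S)"
    then have CS: "C \<subseteq> S" and tot: "\<And>a b. a \<in> C \<Longrightarrow> b \<in> C \<Longrightarrow> a \<le> b \<or> b \<le> a"
      unfolding Chains_def relation_of_def by auto
    show "\<exists>m\<in>S. \<forall>a\<in>C. m \<le> a"
    proof (cases "C = {}")
      case True
      then show ?thesis using p S_def by auto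
    next
      case False
      define m where "m u = (INF a\<in>C. a u)" for u
      have "- p (- u) \<le> a u" if "a \<in> C" for a u
        using CS that sublinear_minus[of a u] unfolding S_def le_fun_def
        by (smt (verit, best) mem_Collect_eq subsetD)
      then have bdd: "bdd_below ((\<lambda>a. a u) ` C)" for u
        by (intro bdd_belowI2)
      have up: "m u \<le> a u" if "a \<in> C" for a u
        unfolding m_def by (rule cINF_lower[OF bdd that])
      have greatest: "l \<le> m u" if "\<And>a. a \<in> C \<Longrightarrow> l \<le> a u" for l u
        unfolding m_def by (rule cINF_greatest[OF False that])
      have sub: "a (u + v) \<le> a u + a v" "t > 0 \<Longrightarrow> a (t *\<^sub>R u) \<le> t * a u"
        if "a \<in> C" for a t u v
        using that CS unfolding S_def sublinear_def by auto
      have "sublinear m" unfolding sublinear_def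
      proof (intro conjI allI impI)
        fix u v
        \<comment> \<open>Totality of the chain supplies one member \<open>d\<close> below both
          \<open>a\<close> and \<open>b\<close>, and its subadditivity bounds the mixed sum.\<close>
        have "m (u + v) \<le> a u + b v" if ab: "a \<in> C" "b \<in> C" for a b
        proof -
          obtain d where d: "d \<in> C" "d \<le> a" "d \<le> b" using tot[OF ab] ab by blast
          then show ?thesis
            using up[of d "u + v"] sub(1)[of d u v] unfolding le_fun_def
            by (smt (verit, best))
        qed
        then have "m (u + v) - b v \<le> m u" if "b \<in> C" for b
          using that by (intro greatest) (simp add: algebra_simps)
        then have "m (u + v) - m u \<le> m v" by (intro greatest) (simp add: algebra_simps)
        then show "m (u + v) \<le> m u + m v" by simp
      next
        fix t :: real and u assume t: "t > 0"
        have "m (t *\<^sub>R u) / t \<le> a u" if "a \<in> C" for a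
          using up[OF that, of "t *\<^sub>R u"] sub(2)[OF that t, of u] t by (simp add: field_simps)
        then have "m (t *\<^sub>R u) / t \<le> m u" by (rule greatest)
        then show "m (t *\<^sub>R u) \<le> t * m u" using t by (simp add: field_simps)
      qed
      moreover obtain a where "a \<in> C" using False by blast
      ultimately have "m \<in> S" using up CS unfolding S_def le_fun_def
        by (smt (verit, best) mem_Collect_eq subsetD)
      then show ?thesis using up by (auto simp: le_fun_def)
    qed
  qed
  then obtain m where m: "sublinear m" "m \<le> p"
    and minimal: "\<And>a. sublinear a \<Longrightarrow> a \<le> m \<Longrightarrow> a = m"
    unfolding S_def using order_trans by blast
  have add: "m (u + v) = m u + m v" for u v
  proof -
    obtain q where q: "sublinear q" "\<And>w. q w \<le> m w" "\<And>w. q w \<le> m (w + v) - m v"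
      using sublinear_shift[OF m(1), of v] by blast
    \<comment> \<open>Minimality leaves no room for the shift to decrease \<open>m\<close>, so
      \<open>m u \<le> m (u + v) - m v\<close>, the reverse of subadditivity.\<close>
    then have "q = m" using minimal by (simp add: le_fun_def)
    then show ?thesis using q(3)[of u] m(1) unfolding sublinear_def
      by (smt (verit))
  qed
  have neg: "m (- u) = - m u" for u
    using add[of u "- u"] sublinear_zero[OF m(1)] by simp
  have "m (t *\<^sub>R u) = t * m u" for t u
  proof (cases "t \<ge> 0")
    case False
    then show ?thesis using sublinear_scale[OF m(1), of "- t" u] neg[of "t *\<^sub>R u"] by simp
  qed (rule sublinear_scale[OF m(1)])
  then have "linear m" using add by (intro linearI) auto
  then show ?thesis using that m(2) unfolding le_fun_def by blast
qed

text \<open>Shifting the norm by \<open>x\<close> first gives \<open>q (- x) \<le> - norm x\<close>,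
  so any linear \<open>g\<close> below \<open>q\<close> has \<open>g x \<ge> norm x\<close>.\<close>

corollary norming_functional:
  fixes x :: "'a::real_normed_vector"
  obtains g :: "'a \<Rightarrow>\<^sub>L real" where "norm g \<le> 1" "blinfun_apply g x = norm x"
proof -
  have "sublinear (norm :: 'a \<Rightarrow> real)"
    unfolding sublinear_def by (simp add: norm_triangle_ineq)
  then obtain q where q: "sublinear q" "\<And>u. q u \<le> norm u" "\<And>u. q u \<le> norm (u + x) - norm x"
    using sublinear_shift[of norm x] by blast
  obtain g where g: "linear g" "\<And>u. g u \<le> q u"
    using sublinear_dominates_linear[OF q(1)] by blast
  have le: "g u \<le> norm u" for u using g(2)[of u] q(2)[of u] by simp
  have bound: "\<bar>g u\<bar> \<le> 1 * norm u" for u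
    using le[of u] le[of "- u"] linear_neg[OF g(1), of u] by simp
  then have bl: "bounded_linear g"
    using g(1) by (intro bounded_linear.intro bounded_linear_axioms.intro exI[of _ 1]) auto
  have "g x = norm x"
    using le[of x] g(2)[of "- x"] q(3)[of "- x"] linear_neg[OF g(1), of x] by simp
  moreover have "norm (Blinfun g) \<le> 1"
    using bl bound by (intro norm_blinfun_bound) (auto simp: bounded_linear_Blinfun_apply)
  ultimately show ?thesis
    using that[of "Blinfun g"] bl by (simp add: bounded_linear_Blinfun_apply)
qed

section \<open>Weak limits along filters\<close>

text \<open>The neighbourhood filter of \<open>p\<close> is pulled back along \<open>x\<close> and
  joined to \<open>F\<close>; frequent visits are what keeps the resulting filter
  nontrivial.\<close>

lemma limit_along_subfilter:
  assumes "p \<in> topspace X"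
    and freq: "\<And>U. openin X U \<Longrightarrow> p \<in> U \<Longrightarrow> \<exists>\<^sub>F k in F. x k \<in> U"
  obtains G where "G \<le> F" "G \<noteq> bot" "limitin X x p G"
proof
  define G where "G = inf F (filtercomap x (nhdsin X p))"
  show "G \<le> F" by (simp add: G_def)
  show "limitin X x p G"
    unfolding limitin_def
  proof (intro conjI allI impI)
    fix U assume "openin X U \<and> p \<in> U"
    then have "eventually (\<lambda>v. v \<in> U) (nhdsin X p)" by (auto simp: eventually_nhdsin)
    then have "eventually (\<lambda>k. x k \<in> U) (filtercomap x (nhdsin X p))"
      by (auto simp: eventually_filtercomap)
    then show "eventually (\<lambda>k. x k \<in> U) G"
      unfolding G_def by (rule filter_leD[OF inf_le2])
  qed (rule assms(1))
  show "G \<noteq> bot"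
  proof
    assume "G = bot"
    then have "eventually (\<lambda>_. False) G" by simp
    then obtain P Q where P: "eventually P F" and Q: "eventually Q (filtercomap x (nhdsin X p))"
      and PQ: "\<And>k. P k \<and> Q k \<Longrightarrow> False"
      unfolding G_def eventually_inf by blast
    obtain R where R: "eventually R (nhdsin X p)" "\<And>k. R (x k) \<Longrightarrow> Q k"
      using Q unfolding eventually_filtercomap by blast
    obtain U where U: "openin X U" "p \<in> U" "\<And>v. v \<in> U \<Longrightarrow> R v"
      using R(1) assms(1) unfolding eventually_nhdsin by blast
    have "\<exists>\<^sub>F k in F. x k \<in> U \<and> P k"
      using freq[OF U(1,2)] P by (rule frequently_eventually_frequently)
    then obtain k where "x k \<in> U" "P k" by (auto dest: frequently_ex)
    then show False using PQ R(2) U(3) by blast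
  qed
qed

text \<open>If no point of \<open>K\<close> were visited frequently in all its neighbourhoods,
  finitely many eventually avoided open sets would cover \<open>K\<close>.\<close>

lemma compactin_limit_along_subfilter:
  assumes K: "compactin X K" and ev: "eventually (\<lambda>k. x k \<in> K) F" and F: "F \<noteq> bot"
  obtains p G where "p \<in> K" "G \<le> F" "G \<noteq> bot" "limitin X x p G"
proof -
  have "\<exists>p\<in>K. \<forall>U. openin X U \<and> p \<in> U \<longrightarrow> (\<exists>\<^sub>F k in F. x k \<in> U)"
  proof (rule ccontr)
    assume "\<not> ?thesis"
    then have "\<forall>p\<in>K. \<exists>U. openin X U \<and> p \<in> U \<and> (\<forall>\<^sub>F k in F. x k \<notin> U)"
      by (simp add: frequently_def)
    then obtain U where U: "\<And>p. p \<in> K \<Longrightarrow> openin X (U p) \<and> p \<in> U p \<and> (\<forall>\<^sub>F k in F. x k \<notin> U p)"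
      by metis
    then have "\<forall>V\<in>U ` K. openin X V" "K \<subseteq> \<Union>(U ` K)" by auto
    then obtain D where D: "finite D" "D \<subseteq> U ` K" "K \<subseteq> \<Union>D"
      using K unfolding compactin_def by meson
    have "\<forall>\<^sub>F k in F. \<forall>V\<in>D. x k \<notin> V"
      using D(1,2) U by (auto simp: eventually_ball_finite_distrib)
    then have "\<forall>\<^sub>F k in F. False"
      using ev by eventually_elim (use D(3) in blast)
    then show False using F by (simp add: trivial_limit_def)
  qed
  then obtain p where p: "p \<in> K" "\<And>U. openin X U \<Longrightarrow> p \<in> U \<Longrightarrow> \<exists>\<^sub>F k in F. x k \<in> U"
    by blast
  have "p \<in> topspace X" using compactin_subset_topspace[OF K] p(1) by (rule subsetD)
  then obtain G where "G \<le> F" "G \<noteq> bot" "limitin X x p G"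
    using p(2) by (rule limit_along_subfilter)
  then show ?thesis by (rule that[OF p(1)])
qed

section \<open>Weak limits tested by functionals\<close>

lemma topspace_weak_topology [simp]: "topspace weak_topology = (UNIV :: 'a::real_normed_vector set)"
proof -
  have "(UNIV :: 'a set) \<in> {blinfun_apply g -` U | (g :: 'a \<Rightarrow>\<^sub>L real) U. open U}"
    by (intro CollectI exI[of _ 0] exI[of _ UNIV]) auto
  then show ?thesis unfolding weak_topology_def topology_generated_by_topspace by blast
qed

lemma openin_weak_halfspace:
  fixes g :: "'a::real_normed_vector \<Rightarrow>\<^sub>L real"
  shows "open V \<Longrightarrow> openin weak_topology (blinfun_apply g -` V)"
  unfolding weak_topology_def
  by (rule topology_generated_by_Basis, rule CollectI, rule exI[of _ g], rule exI[of _ V]) simp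

text \<open>Preimages under functionals form only a subbase; that a neighbourhood is eventually
  entered passes to finite intersections and to unions, by induction on the generated
  topology.\<close>

lemma limitin_weak_topology:
  fixes x :: "'i \<Rightarrow> 'a::real_normed_vector"
  shows "limitin weak_topology x p F \<longleftrightarrow>
    (\<forall>g :: 'a \<Rightarrow>\<^sub>L real. ((\<lambda>k. blinfun_apply g (x k)) \<longlongrightarrow> blinfun_apply g p) F)"
proof
  assume L: "limitin weak_topology x p F"
  show "\<forall>g :: 'a \<Rightarrow>\<^sub>L real. ((\<lambda>k. blinfun_apply g (x k)) \<longlongrightarrow> blinfun_apply g p) F"
  proof (intro allI topological_tendstoI)
    fix g :: "'a \<Rightarrow>\<^sub>L real" and V :: "real set" assume "open V" "blinfun_apply g p \<in> V"
    then have "eventually (\<lambda>k. x k \<in> blinfun_apply g -` V) F"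
      using L openin_weak_halfspace[of V g] unfolding limitin_def by blast
    then show "eventually (\<lambda>k. blinfun_apply g (x k) \<in> V) F"
      by simp
  qed
next
  assume R: "\<forall>g :: 'a \<Rightarrow>\<^sub>L real. ((\<lambda>k. blinfun_apply g (x k)) \<longlongrightarrow> blinfun_apply g p) F"
  have "p \<in> U \<Longrightarrow> eventually (\<lambda>k. x k \<in> U) F"
    if "generate_topology_on {blinfun_apply g -` U | (g :: 'a \<Rightarrow>\<^sub>L real) U. open U} U" for U
    using that
  proof (induction U rule: generate_topology_on.induct)
    case (Basis U)
    then obtain g :: "'a \<Rightarrow>\<^sub>L real" and V where U: "U = blinfun_apply g -` V" "open V" by blast
    have "eventually (\<lambda>k. blinfun_apply g (x k) \<in> V) F"
      using R U Basis.prems by (intro topological_tendstoD[OF R[rule_format]]) simp_all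
    then show ?case using U(1) by simp
  next
    case (UN K)
    then obtain k where "k \<in> K" "p \<in> k" by blast
    then have "eventually (\<lambda>j. x j \<in> k) F" using UN.IH by simp
    then show ?case by eventually_elim (use \<open>k \<in> K\<close> in blast)
  qed (simp_all add: eventually_conj_iff)
  then have "\<forall>U. openin weak_topology U \<and> p \<in> U \<longrightarrow> eventually (\<lambda>k. x k \<in> U) F"
    unfolding weak_topology_def openin_topology_generated_by_iff by simp
  then show "limitin weak_topology x p F"
    unfolding limitin_def by simp
qed

lemma limitin_weak_topology_blinfun:
  fixes g :: "'a::real_normed_vector \<Rightarrow>\<^sub>L real"
  assumes "limitin weak_topology x p F"
  shows "((\<lambda>k. blinfun_apply g (x k)) \<longlongrightarrow> blinfun_apply g p) F"
  using assms unfolding limitin_weak_topology by (rule spec)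

lemma limitin_subfilter:
  assumes "limitin X x p F" "G \<le> F"
  shows "limitin X x p G"
  unfolding limitin_def
proof (intro conjI allI impI)
  show "p \<in> topspace X" using assms(1) by (rule limitin_topspace)
  fix U assume "openin X U \<and> p \<in> U"
  then have "eventually (\<lambda>k. x k \<in> U) F" using assms(1) unfolding limitin_def by blast
  then show "eventually (\<lambda>k. x k \<in> U) G" by (rule filter_leD[OF assms(2)])
qed

lemma tendsto_imp_limitin_weak:
  assumes "(x \<longlongrightarrow> p) F"
  shows "limitin weak_topology x p F"
  unfolding limitin_weak_topology by (rule allI, rule blinfun.tendsto[OF tendsto_const assms])

text \<open>Norm convergence implies weak convergence; for the identity along \<open>nhds p\<close>
  this makes \<open>p\<close> an interior point.\<close>

lemma openin_weak_imp_open: "openin weak_topology U \<Longrightarrow> open U"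
proof -
  assume U: "openin weak_topology U"
  have "\<forall>\<^sub>F v in nhds p. v \<in> U" if "p \<in> U" for p
    using tendsto_imp_limitin_weak[OF filterlim_ident, of p] U that by (simp add: limitin_def)
  then show "open U"
    by (subst open_subopen) (auto simp: eventually_nhds subset_eq)
qed

text \<open>A functional on the product is the sum of its restrictions to the two factors.\<close>

lemma limitin_weak_Pair:
  fixes x :: "'i \<Rightarrow> 'a::real_normed_vector" and z :: "'i \<Rightarrow> 'b::real_normed_vector"
  assumes "limitin weak_topology x p F" "limitin weak_topology z q F"
  shows "limitin weak_topology (\<lambda>k. (x k, z k)) (p, q) F"
  unfolding limitin_weak_topology
proof
  fix g :: "('a \<times> 'b) \<Rightarrow>\<^sub>L real"
  have bl: "bounded_linear (\<lambda>u. blinfun_apply g (u, 0))" "bounded_linear (\<lambda>v. blinfun_apply g (0, v))"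
    by (auto intro!: bounded_linear_intros)
  define g1 g2 where "g1 = Blinfun (\<lambda>u. blinfun_apply g (u, 0))"
    and "g2 = Blinfun (\<lambda>v. blinfun_apply g (0, v))"
  have split: "blinfun_apply g (u, v) = blinfun_apply g1 u + blinfun_apply g2 v" for u v
    using blinfun.add_right[of g "(u, 0)" "(0, v)"] bl
    by (simp add: g1_def g2_def bounded_linear_Blinfun_apply)
  show "((\<lambda>k. blinfun_apply g (x k, z k)) \<longlongrightarrow> blinfun_apply g (p, q)) F"
    unfolding split by (intro tendsto_add limitin_weak_topology_blinfun assms)
qed

text \<open>The pairs \<open>(x k, t)\<close> with constant \<open>t\<close> lie eventually in the
  epigraph, which is weakly closed.\<close>

lemma w_lsc_limit_le:
  fixes g :: "'a::real_normed_vector \<Rightarrow> ereal"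
  assumes g: "w_lsc g" and x: "limitin weak_topology x p F" and F: "F \<noteq> bot"
    and le: "eventually (\<lambda>k. g (x k) \<le> ereal t) F"
  shows "g p \<le> ereal t"
proof -
  have "limitin weak_topology (\<lambda>k. (x k, t)) (p, t) F"
    by (intro limitin_weak_Pair x tendsto_imp_limitin_weak tendsto_const)
  then have "(p, t) \<in> {(x, t::real). g x \<le> ereal t}"
    by (rule limitin_closedin) (use g F le in \<open>auto simp: w_lsc_def\<close>)
  then show ?thesis by simp
qed

section \<open>Uniform boundedness\<close>

lemma Baire_closed_cover_contains_cball:
  fixes C :: "nat \<Rightarrow> ('a::complete_space) set"
  assumes "\<And>m. closed (C m)" and U: "(\<Union>m. C m) = UNIV"
  obtains m a r where "r > 0" "cball a r \<subseteq> C m"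
proof -
  have "\<exists>m. interior (C m) \<noteq> {}"
  proof (rule ccontr)
    assume "\<not> ?thesis"
    then have "Met_TC.mtopology interior_of (\<Union>(range C)) = {}"
      using assms(1) by (intro Met_TC.metric_Baire_category_alt) auto
    then show False using U by simp
  qed
  then obtain m a where "a \<in> interior (C m)" by blast
  then obtain r where "r > 0" "cball a r \<subseteq> interior (C m)"
    using open_contains_cball[of "interior (C m)"] by auto
  then show ?thesis using that interior_subset by blast
qed

text \<open>The uniform boundedness principle for the points of \<open>B\<close> acting on the dual
  space, whose completeness admits the Baire argument; norming functionals turn the result into a
  bound on \<open>norm u\<close>.\<close>

theorem bounded_if_functionals_bounded:
  fixes B :: "'a::real_normed_vector set"
  assumes bdd: "\<And>g :: 'a \<Rightarrow>\<^sub>L real. bounded (blinfun_apply g ` B)"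
  shows "bounded B"
proof -
  define C where "C m = {g :: 'a \<Rightarrow>\<^sub>L real. \<forall>u\<in>B. \<bar>blinfun_apply g u\<bar> \<le> real m}" for m :: nat
  have "C m = (\<Inter>u\<in>B. {g. \<bar>blinfun_apply g u\<bar> \<le> real m})" for m
    unfolding C_def by auto
  moreover have "closed {g :: 'a \<Rightarrow>\<^sub>L real. \<bar>blinfun_apply g u\<bar> \<le> real m}" for u m
    by (intro closed_Collect_le continuous_on_rabs blinfun.continuous_on continuous_on_id
        continuous_on_const)
  ultimately have "closed (C m)" for m
    by (auto intro: closed_INT)
  moreover have "(\<Union>m. C m) = UNIV"
  proof (intro equalityI subset_UNIV subsetI)
    fix g :: "'a \<Rightarrow>\<^sub>L real"
    obtain b where b: "\<And>u. u \<in> B \<Longrightarrow> \<bar>blinfun_apply g u\<bar> \<le> b"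
      using bdd[of g] unfolding bounded_iff by auto
    obtain m :: nat where "b \<le> m" using real_arch_simple by blast
    then have "g \<in> C m" using b unfolding C_def by force
    then show "g \<in> (\<Union>m. C m)" by blast
  qed
  ultimately obtain m a r where r: "r > 0" "cball a r \<subseteq> C m"
    by (rule Baire_closed_cover_contains_cball)
  have "norm u \<le> 2 * real m / r" if u: "u \<in> B" for u
  proof -
    obtain h :: "'a \<Rightarrow>\<^sub>L real" where h: "norm h \<le> 1" "blinfun_apply h u = norm u"
      by (rule norming_functional)
    \<comment> \<open>Both the centre and its translate by \<open>r *\<^sub>R h\<close> lie in
      \<open>C m\<close>; subtracting the two bounds isolates \<open>r * norm u\<close>.\<close>
    have "a \<in> C m" "a + r *\<^sub>R h \<in> C m"
      using r(1) h(1) by (auto simp: dist_norm intro!: subsetD[OF r(2)])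
    then have "\<bar>blinfun_apply a u\<bar> \<le> m" "\<bar>blinfun_apply a u + r * norm u\<bar> \<le> m"
      using u h(2) unfolding C_def by (auto simp: blinfun.add_left blinfun.scaleR_left)
    then have "r * norm u \<le> 2 * real m" by linarith
    then show ?thesis using r(1) by (simp add: field_simps)
  qed
  then show ?thesis unfolding bounded_iff by blast
qed

corollary weakly_compact_imp_bounded:
  fixes B :: "'a::real_normed_vector set"
  assumes "weakly_compact B"
  shows "bounded B"
proof (rule bounded_if_functionals_bounded)
  fix g :: "'a \<Rightarrow>\<^sub>L real"
  have "continuous_map weak_topology euclidean (blinfun_apply g)"
    unfolding continuous_map_def using openin_weak_halfspace[of _ g]
    by (auto simp: vimage_def)
  then have "compactin euclidean (blinfun_apply g ` (weak_topology closure_of B))"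
    using assms image_compactin unfolding weakly_compact_def by blast
  moreover have "B \<subseteq> weak_topology closure_of B"
    by (intro closure_of_subset) simp
  ultimately show "bounded (blinfun_apply g ` B)"
    by (metis bounded_subset compact_imp_bounded compactin_euclidean_iff image_mono)
qed

section \<open>Weak limits of bounded families in Hilbert space\<close>

text \<open>Up to a constant, \<open>J\<close> is the squared distance to the representing vector.
  The parallelogram identity makes a minimizing sequence Cauchy, and stationarity at its limit is
  the representation.\<close>

theorem Riesz_representation:
  fixes g :: "'h::{real_inner, banach} \<Rightarrow> real"
  assumes g: "bounded_linear g"
  obtains p where "\<And>y. g y = p \<bullet> y"
proof -
  interpret bounded_linear g by (rule g)
  define J where "J u = u \<bullet> u - 2 * g u" for u
  define d where "d = (INF u. J u)"
  obtain m where m: "\<And>u. \<bar>g u\<bar> \<le> norm u * m" using bounded by auto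
  have "- (m^2) \<le> J u" for u
  proof -
    have "0 \<le> (norm u - m)^2" by simp
    then show ?thesis using m[of u] unfolding J_def power2_norm_eq_inner[symmetric]
      by (simp add: power2_diff algebra_simps)
  qed
  then have bdd: "bdd_below (range J)" by (intro bdd_belowI2)
  have low: "d \<le> J u" for u unfolding d_def by (rule cINF_lower[OF bdd]) simp
  have "\<exists>u. J u < d + 1 / real (Suc n)" for n
    using cInf_lessD[of "range J" "d + 1 / real (Suc n)"] unfolding d_def by auto
  then obtain u where u: "\<And>n. J (u n) < d + 1 / real (Suc n)" by metis
  have par: "norm (v - w) ^ 2 = 2 * J v + 2 * J w - 4 * J ((1/2) *\<^sub>R (v + w))" for v w
    unfolding J_def power2_norm_eq_inner
    by (simp add: add scaleR inner_simps inner_commute algebra_simps)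
  have "Cauchy u"
  proof (rule metric_CauchyI)
    fix e :: real assume "e > 0"
    \<comment> \<open>Both values of \<open>J\<close> exceed \<open>d\<close> by at most
      \<open>1 / real (Suc N)\<close> and enter \<open>par\<close> with factor 2, whence the
      4.\<close>
    then obtain N where N: "4 / real (Suc N) < e^2"
      using reals_Archimedean[of "e^2 / 4"] by (auto simp: field_simps)
    have "dist (u i) (u j) < e" if "i \<ge> N" "j \<ge> N" for i j
    proof -
      have "1 / real (Suc i) \<le> 1 / real (Suc N)" "1 / real (Suc j) \<le> 1 / real (Suc N)"
        using that by (auto intro!: divide_left_mono)
      then have "norm (u i - u j) ^ 2 < e^2"
        using par[of "u i" "u j"] u[of i] u[of j] low[of "(1/2) *\<^sub>R (u i + u j)"] N by linarith
      then show ?thesis using \<open>e > 0\<close> by (simp add: dist_norm power2_less_imp_less)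
    qed
    then show "\<exists>M. \<forall>i\<ge>M. \<forall>j\<ge>M. dist (u i) (u j) < e" by blast
  qed
  then obtain p where p: "u \<longlonglongrightarrow> p" using Cauchy_convergent convergent_def by blast
  have "(\<lambda>n. J (u n)) \<longlonglongrightarrow> J p" unfolding J_def by (intro tendsto_intros tendsto p)
  moreover have "(\<lambda>n. d + 1 / real (Suc n)) \<longlonglongrightarrow> d + 0"
    by (intro tendsto_intros LIMSEQ_Suc lim_1_over_n)
  ultimately have "J p \<le> d"
    using u by (intro LIMSEQ_le) (auto intro: less_imp_le)
  then have min: "J p \<le> J (p + t *\<^sub>R y)" for t y using low[of "p + t *\<^sub>R y"] by simp
  have "g y = p \<bullet> y" for y
  proof (cases "y = 0")
    case False
    \<comment> \<open>This is the minimizer of the quadratic \<open>J (p + t *\<^sub>R y)\<close> in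
      \<open>t\<close>; it would lower \<open>J\<close> strictly unless
      \<open>g y = p \<bullet> y\<close>.\<close>
    define t where "t = (g y - p \<bullet> y) / (y \<bullet> y)"
    have "t * (y \<bullet> y) = g y - p \<bullet> y" using False by (simp add: t_def)
    moreover have "0 \<le> t * (t * (y \<bullet> y)) - 2 * t * (g y - p \<bullet> y)"
      using min[of t y] unfolding J_def
      by (simp add: add scaleR inner_simps inner_commute algebra_simps)
    ultimately have "t * (g y - p \<bullet> y) \<le> 0" by simp
    then have "(g y - p \<bullet> y)^2 / (y \<bullet> y) \<le> 0"
      unfolding t_def by (simp add: power2_eq_square)
    then have "(g y - p \<bullet> y)^2 \<le> 0"
      by (metis False divide_le_0_iff inner_gt_zero_iff linorder_not_less)
    then show ?thesis by simp
  qed simp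
  then show ?thesis using that by blast
qed

text \<open>Through the functions \<open>y \<mapsto> x k \<bullet> y\<close> the family runs in a
  product of compact intervals; a pointwise limit there is linear and bounded, hence represented by
  a vector.\<close>

theorem bounded_weak_limit_along_subfilter:
  fixes x :: "'i \<Rightarrow> 'h::{real_inner, banach}"
  assumes bdd: "eventually (\<lambda>k. norm (x k) \<le> R) F" and F: "F \<noteq> bot"
  obtains p G where "G \<le> F" "G \<noteq> bot" "limitin weak_topology x p G"
proof -
  define T where "T = product_topology (\<lambda>_ :: 'h. euclidean :: real topology) UNIV"
  define K where "K = (\<Pi>\<^sub>E y\<in>(UNIV :: 'h set). {- (R * norm y)..R * norm y})"
  have "compactin T K" unfolding T_def K_def compactin_PiE by simp
  moreover have "eventually (\<lambda>k. (\<lambda>y. x k \<bullet> y) \<in> K) F"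
    using bdd
  proof eventually_elim
    case (elim k)
    have "\<bar>x k \<bullet> y\<bar> \<le> R * norm y" for y
      using Cauchy_Schwarz_ineq2[of "x k" y] mult_right_mono[OF elim norm_ge_zero[of y]] by linarith
    then show ?case unfolding K_def by (auto simp: abs_le_iff minus_le_iff)
  qed
  ultimately obtain l G where l: "l \<in> K" and G: "G \<le> F" "G \<noteq> bot"
    and "limitin T (\<lambda>k y. x k \<bullet> y) l G"
    by (rule compactin_limit_along_subfilter[OF _ _ F])
  then have lim: "((\<lambda>k. x k \<bullet> y) \<longlongrightarrow> l y) G" for y
    unfolding T_def limitin_componentwise by simp
  have "l (u + v) = l u + l v" for u v
    by (rule tendsto_unique[OF G(2) lim])
      (use tendsto_add[OF lim[of u] lim[of v]] in \<open>simp add: inner_add_right\<close>)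
  moreover have "l (t *\<^sub>R u) = t *\<^sub>R l u" for t u
    by (rule tendsto_unique[OF G(2) lim])
      (use tendsto_scaleR[OF tendsto_const lim[of u]] in simp)
  moreover have "norm (l u) \<le> norm u * R" for u
    using l unfolding K_def by (auto simp: PiE_iff abs_le_iff mult.commute minus_le_iff)
  ultimately have "bounded_linear l" by (rule bounded_linear_intro)
  then obtain p where p: "\<And>y. l y = p \<bullet> y" using Riesz_representation by blast
  have "limitin weak_topology x p G" unfolding limitin_weak_topology
  proof
    fix g :: "'h \<Rightarrow>\<^sub>L real"
    obtain y where "\<And>u. blinfun_apply g u = y \<bullet> u"
      using Riesz_representation[OF blinfun.bounded_linear_right] by metis
    then show "((\<lambda>k. blinfun_apply g (x k)) \<longlongrightarrow> blinfun_apply g p) G"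
      using lim[of y] p by (simp add: inner_commute)
  qed
  then show ?thesis using that G by blast
qed

section \<open>Semicontinuity along subfilters\<close>

text \<open>The filter counterpart of passing to a subsequence on which \<open>P\<close>
  holds.\<close>

lemma frequently_imp_subfilter_nonbot:
  assumes "\<exists>\<^sub>F k in F. P k"
  shows "inf F (principal {k. P k}) \<noteq> bot"
proof
  assume "inf F (principal {k. P k}) = bot"
  then have "eventually (\<lambda>_. False) (inf F (principal {k. P k}))" by (simp only: eventually_bot)
  then show False using assms unfolding eventually_inf_principal frequently_def by simp
qed

lemma eventually_in_subfilter: "eventually P (inf F (principal {k. P k}))"
  by (simp add: eventually_inf_principal)

text \<open>Otherwise \<open>g (z k) \<ge> b\<close> would hold along a subfilter and, the epigraph
  of \<open>- g\<close> being weakly closed, persist at \<open>p\<close>.\<close>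

lemma w_usc_eventually_less:
  fixes g :: "'a::real_normed_vector \<Rightarrow> ereal"
  assumes g: "w_usc g" and z: "limitin weak_topology z p F" and less: "g p < ereal b"
  shows "eventually (\<lambda>k. g (z k) < ereal b) F"
proof (rule ccontr)
  assume "\<not> ?thesis"
  then have freq: "\<exists>\<^sub>F k in F. - g (z k) \<le> ereal (- b)"
    by (simp add: not_eventually not_less ereal_uminus_le_reorder)
  let ?G = "inf F (principal {k. - g (z k) \<le> ereal (- b)})"
  have "- g p \<le> ereal (- b)"
  proof (rule w_lsc_limit_le)
    show "w_lsc (\<lambda>x. - g x)" using g by (simp add: w_usc_def)
    show "limitin weak_topology z p ?G" by (rule limitin_subfilter[OF z inf_le1])
    show "?G \<noteq> bot" by (rule frequently_imp_subfilter_nonbot[OF freq])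
    show "\<forall>\<^sub>F k in ?G. - g (z k) \<le> ereal (- b)" by (rule eventually_in_subfilter)
  qed
  then have "ereal b \<le> g p" using ereal_minus_le_minus[of "g p" "ereal b"] by simp
  then show False using less by simp
qed

text \<open>\<open>small\<close> controls \<open>\<sigma>\<close> only away from the origin, because
  the lower bound on the stepsizes may degenerate as \<open>z k\<close> approaches \<open>0\<close>.
  A weak neighbourhood of \<open>0\<close> contains a norm ball, so points outside it fall under
  \<open>small\<close>, and a weak cluster point of them would be a second minimizer.\<close>

lemma unique_minimizer_weakly_attracts:
  fixes z :: "'i \<Rightarrow> 'h::{real_inner, banach}"
  assumes \<sigma>: "w_lsc \<sigma>" "minimizers \<sigma> = {0}" "\<sigma> 0 = 0"
    and bdd: "\<And>k. norm (z k) \<le> R"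
    and small: "\<And>\<rho> e. \<rho> > 0 \<Longrightarrow> e > 0 \<Longrightarrow>
      \<forall>\<^sub>F k in F. norm (z k) \<ge> \<rho> \<longrightarrow> \<sigma> (z k) \<le> ereal e"
  shows "limitin weak_topology z 0 F"
proof (rule ccontr)
  assume "\<not> ?thesis"
  then obtain U where U: "openin weak_topology U" "0 \<in> U" and "\<not> (\<forall>\<^sub>F k in F. z k \<in> U)"
    by (auto simp: limitin_def)
  then have freq: "\<exists>\<^sub>F k in F. z k \<notin> U" by (simp add: not_eventually)
  define G where "G = inf F (principal {k. z k \<notin> U})"
  have G: "G \<noteq> bot" "G \<le> F" "eventually (\<lambda>k. z k \<notin> U) G"
    unfolding G_def using frequently_imp_subfilter_nonbot[OF freq] eventually_in_subfilter by auto
  obtain p G' where G': "G' \<le> G" "G' \<noteq> bot" and p: "limitin weak_topology z p G'"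
    by (rule bounded_weak_limit_along_subfilter[OF always_eventually[OF allI[OF bdd]] G(1)])
  have out: "eventually (\<lambda>k. z k \<in> - U) G'"
    using filter_leD[OF G'(1) G(3)] by simp
  have "closedin weak_topology (- U)" using U(1) by (simp add: closedin_def Diff_eq)
  then have "p \<in> - U" using limitin_closedin[OF p _ out] G'(2) by simp
  then have "p \<noteq> 0" using U(2) by auto
  obtain \<rho> where \<rho>: "\<rho> > 0" "ball 0 \<rho> \<subseteq> U"
    using openin_weak_imp_open[OF U(1)] U(2) open_contains_ball[of U] by blast
  have "\<sigma> p \<le> ereal e" if "e > 0" for e
  proof (rule w_lsc_limit_le[OF \<sigma>(1) p G'(2)])
    have "\<forall>\<^sub>F k in G'. norm (z k) \<ge> \<rho> \<longrightarrow> \<sigma> (z k) \<le> ereal e"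
      by (rule filter_leD[OF order_trans[OF G'(1) G(2)] small[OF \<rho>(1) that]])
    with out show "\<forall>\<^sub>F k in G'. \<sigma> (z k) \<le> ereal e"
    proof eventually_elim
      case (elim k)
      then have "z k \<notin> ball 0 \<rho>" using \<rho>(2) by blast
      then show ?case using elim(2) by simp
    qed
  qed
  then have "\<sigma> p \<le> 0" by (rule ereal_le_epsilon2[of _ 0, simplified])
  moreover have "0 \<in> minimizers \<sigma>" using \<sigma>(2) by simp
  ultimately have "p \<in> minimizers \<sigma>"
    using \<sigma>(3) order_trans[of "\<sigma> p" 0] unfolding minimizers_def by simp
  then show False using \<sigma>(2) \<open>p \<noteq> 0\<close> by simp
qed

section \<open>The perturbation function and the dual method\<close>

text \<open>Any eventual bound on \<open>v\<close> along a subfilter bounds \<open>\<phi>\<close> at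
  a weak limit of \<open>x\<close> there, because \<open>f\<close> is semicontinuous at
  \<open>(p, 0)\<close>. The bound \<open>M\<close> gives optimality, and a bound below
  \<open>M\<close> is impossible.\<close>

lemma perturbed_minimizing_sequence:
  fixes f :: "'a::real_normed_vector \<times> 'h::real_normed_vector \<Rightarrow> ereal"
  assumes f0: "\<And>u. f (u, 0) = \<phi> u" and f: "w_lsc f" "weakly_level_compact f"
    and M: "primal_value \<phi> = ereal M"
    and z: "limitin weak_topology z 0 sequentially"
    and le: "\<And>k. v k \<le> M"
    and approx: "\<And>e. e > 0 \<Longrightarrow> \<forall>\<^sub>F k in sequentially. f (x k, z k) \<le> ereal (v k + e)"
  shows "bounded (range x)"
    and "weak_accumulation_point x p \<Longrightarrow> p \<in> minimizers \<phi>"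
    and "v \<longlonglongrightarrow> M"
proof -
  have lower: "ereal M \<le> \<phi> u" for u
    unfolding M[symmetric] primal_value_def by (rule INF_lower) simp
  have upper: "\<phi> p \<le> ereal b"
    if G: "G \<le> sequentially" "G \<noteq> bot" and x: "limitin weak_topology x p G"
      and v: "eventually (\<lambda>k. v k \<le> b) G" for p G b
  proof -
    have "\<phi> p \<le> ereal b + ereal e" if "e > 0" for e
    proof -
      have "f (p, 0) \<le> ereal (b + e)"
      proof (rule w_lsc_limit_le[OF f(1) _ G(2)])
        show "limitin weak_topology (\<lambda>k. (x k, z k)) (p, 0) G"
          by (intro limitin_weak_Pair x limitin_subfilter[OF z G(1)])
        show "\<forall>\<^sub>F k in G. f (x k, z k) \<le> ereal (b + e)"
          using filter_leD[OF G(1) approx[OF that]] v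
        proof eventually_elim
          case (elim k)
          have "ereal (v k + e) \<le> ereal (b + e)" using elim(2) by simp
          with elim(1) show ?case by (rule order_trans)
        qed
      qed
      then show ?thesis using f0 by simp
    qed
    then show ?thesis by (rule ereal_le_epsilon2[rule_format])
  qed
  \<comment> \<open>The level \<open>M + 1\<close> accommodates \<open>v k + 1\<close>, which
    \<open>approx\<close> yields for \<open>e = 1\<close>.\<close>
  obtain U B where U: "openin weak_topology U" "0 \<in> U" and B: "weakly_compact B"
    and UB: "\<And>u w. w \<in> U \<Longrightarrow> f (u, w) \<le> ereal (M + 1) \<Longrightarrow> u \<in> B"
    using f(2)[unfolded weakly_level_compact_def, rule_format, of 0 "M + 1"] by blast
  have evB: "\<forall>\<^sub>F k in sequentially. x k \<in> B"
  proof -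
    have "\<forall>\<^sub>F k in sequentially. z k \<in> U" using z U by (simp add: limitin_def)
    with approx[of 1, simplified] show ?thesis
    proof eventually_elim
      case (elim k)
      have "f (x k, z k) \<le> ereal (M + 1)"
        by (rule order_trans[OF elim(1)]) (simp add: le)
      then show ?case using UB elim(2) by blast
    qed
  qed
  then obtain N where N: "\<And>k. k \<ge> N \<Longrightarrow> x k \<in> B" unfolding eventually_sequentially by blast
  have "range x \<subseteq> x ` {..<N} \<union> B"
  proof
    fix u assume "u \<in> range x"
    then obtain k where "u = x k" by blast
    then show "u \<in> x ` {..<N} \<union> B" using N[of k] by (cases "k < N") auto
  qed
  moreover have "bounded (x ` {..<N} \<union> B)"
    using weakly_compact_imp_bounded[OF B] by (simp add: finite_imp_bounded)
  ultimately show "bounded (range x)" by (rule bounded_subset[rotated])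
  show "p \<in> minimizers \<phi>" if acc: "weak_accumulation_point x p"
  proof -
    obtain G where G: "G \<le> sequentially" "G \<noteq> bot" "limitin weak_topology x p G"
    proof (rule limit_along_subfilter[of p weak_topology x sequentially])
      show "p \<in> topspace weak_topology" by simp
    qed (use acc in \<open>simp_all add: weak_accumulation_point_def\<close>)
    have "\<phi> p \<le> ereal M" by (rule upper[OF G]) (simp add: le)
    then show ?thesis using order_trans[OF _ lower] by (simp add: minimizers_def)
  qed
  show "v \<longlonglongrightarrow> M"
  proof (rule order_tendstoI)
    fix a assume "a > M"
    then show "\<forall>\<^sub>F k in sequentially. v k < a" using le_less_trans[OF le] by simp
  next
    fix a assume a: "a < M"
    show "\<forall>\<^sub>F k in sequentially. a < v k"
    proof (rule ccontr)
      assume "\<not> ?thesis"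
      then have freq: "\<exists>\<^sub>F k in sequentially. v k \<le> a" by (simp add: not_eventually not_less)
      let ?F = "inf sequentially (principal {k. v k \<le> a})"
      \<comment> \<open>\<open>weakly_compact\<close> speaks of the closure of \<open>B\<close>, so
        the cluster point is sought there.\<close>
      have "\<forall>\<^sub>F k in ?F. x k \<in> weak_topology closure_of B"
        using filter_leD[OF inf_le1 evB]
        by (rule eventually_mono) (use closure_of_subset[of B weak_topology] in auto)
      then obtain p G where G: "G \<le> ?F" "G \<noteq> bot" "limitin weak_topology x p G"
        by (rule compactin_limit_along_subfilter[OF B[unfolded weakly_compact_def] _
            frequently_imp_subfilter_nonbot[OF freq]])
      have "\<phi> p \<le> ereal a"
        by (rule upper[OF _ G(2,3) filter_leD[OF G(1) eventually_in_subfilter]])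
          (use G(1) in simp)
      with lower[of p] have "ereal M \<le> ereal a" by (rule order_trans)
      then show False using a by simp
    qed
  qed
qed

section \<open>Search step, weak duality and growth of the dual iterates\<close>

lemma near_minimizers_mono:
  "r \<le> r' \<Longrightarrow> near_minimizers f A \<sigma> r y c \<subseteq> near_minimizers f A \<sigma> r' y c"
proof (unfold near_minimizers_def, clarify)
  fix u w assume "r \<le> r'"
    and "augmented_objective f A \<sigma> y c u w \<le> dual_function f A \<sigma> y c + ereal r"
  moreover have "dual_function f A \<sigma> y c + ereal r \<le> dual_function f A \<sigma> y c + ereal r'"
    using \<open>r \<le> r'\<close> by (intro add_left_mono) simp
  ultimately show "augmented_objective f A \<sigma> y c u w \<le> dual_function f A \<sigma> y c + ereal r'"
    by (metis order_trans)
qed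

text \<open>A retry happens only at \<open>r > \<epsilon> > 0\<close>, where
  \<open>\<delta> < 1\<close> gives \<open>\<delta> * r \<le> r\<close> whatever the sign of
  \<open>\<delta>\<close>; the search never raises the tolerance.\<close>

lemma dsg_search_near_minimizer:
  assumes "dsg_search f A \<sigma> \<epsilon> \<delta> y c r x z" and "\<epsilon> > 0" "\<delta> < 1"
  shows "(x, z) \<in> near_minimizers f A \<sigma> r y c"
  using assms(1)
proof induction
  case (retry x' r x z)
  have "\<delta> * r \<le> r" using retry.hyps(2) assms(2,3) by simp
  then show ?case using retry.IH near_minimizers_mono by blast
qed

text \<open>At perturbation \<open>0\<close> both the coupling and the penalty vanish.\<close>

lemma weak_duality:
  assumes "A 0 = 0" "\<sigma> 0 = 0" "\<And>u. f (u, 0) = \<phi> u"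
  shows "dual_function f A \<sigma> y c \<le> primal_value \<phi>"
  unfolding primal_value_def
proof (rule INF_greatest)
  fix u
  have "dual_function f A \<sigma> y c \<le> augmented_objective f A \<sigma> y c u 0"
    unfolding dual_function_def by (intro INF_lower2[of u] INF_lower2[of 0]) auto
  also have "\<dots> = \<phi> u" using assms unfolding augmented_objective_def by simp
  finally show "dual_function f A \<sigma> y c \<le> \<phi> u" .
qed

text \<open>One step moves \<open>y\<close> by at most \<open>s k * t k\<close> but raises
  \<open>c\<close> by \<open>(\<alpha> k + 1) * s k * t k\<close>; the sum collects the
  surplus.\<close>

lemma deflection_dominates_dual_step:
  fixes y a :: "nat \<Rightarrow> 'h::real_normed_vector" and c s \<alpha> t :: "nat \<Rightarrow> real"
  assumes "\<And>k. y (Suc k) = y k - s k *\<^sub>R a k" "\<And>k. c (Suc k) = c k + (\<alpha> k + 1) * s k * t k"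
    and "\<And>k. s k \<ge> 0" "\<And>k. norm (a k) \<le> t k"
  shows "(\<Sum>j<k. \<alpha> j * s j * t j) + norm (y k - y 0) \<le> c k - c 0"
proof (induction k)
  case (Suc k)
  have "norm (y (Suc k) - y 0) \<le> norm (y k - y 0) + norm (s k *\<^sub>R a k)"
    using norm_triangle_ineq4[of "y k - y 0" "s k *\<^sub>R a k"] unfolding assms(1)
    by (simp only: diff_diff_eq add.commute)
  also have "norm (s k *\<^sub>R a k) \<le> s k * t k"
    using assms(3,4)[of k] by (simp add: mult_left_mono)
  finally show ?case using Suc assms(2)[of k] by (simp add: algebra_simps)
qed simp

theorem theorem4p2:
  fixes \<phi> :: "'a::banach \<Rightarrow> ereal"
    and f :: "'a \<times> 'h::{real_inner, banach} \<Rightarrow> ereal"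
    and \<sigma> :: "'h \<Rightarrow> ereal"
    and A :: "'h \<Rightarrow> 'h"
    and \<eta> \<beta> \<epsilon> \<delta> \<alpha>bar rtilde chat :: real
    and yhat :: 'h
    and \<alpha> r s c :: "nat \<Rightarrow> real"
    and x :: "nat \<Rightarrow> 'a"
    and z y :: "nat \<Rightarrow> 'h"
  assumes "reflexive_space TYPE('a)"
    and "proper \<phi>" and "w_lsc \<phi>" and "\<And>a::real. weakly_compact {u. \<phi> u \<le> ereal a}"
    and "\<And>u. f (u, 0) = \<phi> u"
    and "proper f" and "w_lsc f" and "weakly_level_compact f"
    and "augmenting \<sigma>"
    and "\<And>v. ereal (norm (A v)) \<le> \<sigma> v"
    and "\<And>w. w_usc (\<lambda>v. ereal (A v \<bullet> w))"
    and "\<exists>ybar. \<exists>cbar\<ge>0. dual_function f A \<sigma> ybar cbar > -\<infinity>"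
    and sigma_property:
      "\<And>w :: nat \<Rightarrow> 'h. decseq (\<lambda>k. \<sigma> (w k)) \<Longrightarrow> (\<lambda>k. \<sigma> (w k)) \<longlonglongrightarrow> 0 \<Longrightarrow> bounded (range w)"
    and no_gap: "primal_value \<phi> = dual_value f A \<sigma>"
    and run: "dsg1_run f A \<sigma> \<eta> \<beta> \<epsilon> \<delta> \<alpha> r s x z y c"
    and "\<alpha>bar > 0" and "\<And>k. \<alpha> k \<ge> \<alpha>bar"
    and "chat \<ge> 0" and "dual_function f A \<sigma> yhat chat > -\<infinity>"
    and "\<And>k. r k \<le> rtilde"
    and initial_choice:
      "(coercive \<sigma> \<and> y 0 = yhat \<and> c 0 > chat) \<or>
       (\<exists>K. conditionally_coercive_with K \<sigma> \<and> y 0 = yhat \<and>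
          (\<exists>S::real. ereal S \<ge> primal_value \<phi> \<and>
             ereal (c 0) > ereal chat + (ereal S - dual_function f A \<sigma> yhat chat) / ereal K) \<and>
          ereal (\<alpha> 0 * s 0) >
            (primal_value \<phi> - dual_function f A \<sigma> (y 0) (c 0) + ereal rtilde)
              / (ereal K * \<sigma> (z 0)))"
  shows "bounded (range x) \<and>
    (\<forall>p. weak_accumulation_point x p \<longrightarrow> p \<in> minimizers \<phi>) \<and>
    (\<lambda>k. dual_function f A \<sigma> (y k) (c k)) \<longlonglongrightarrow> primal_value \<phi>"
proof -

  \<comment> \<open>Real-valued data of the run\<close>
  have \<sigma>: "w_lsc \<sigma>" "minimizers \<sigma> = {0}" "\<sigma> 0 = 0"
    using assms(9) by (auto simp: augmenting_def)
  have \<sigma>_nonneg: "0 \<le> \<sigma> v" for v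
    using order_trans[OF _ assms(10)[of v], of 0] by simp
  have A0: "A 0 = 0" using assms(10)[of 0] \<sigma>(3) by (simp add: zero_ereal_def)
  have dsg: "dsg_run f A \<sigma> \<epsilon> \<delta> \<alpha> r s x z y c"
    and step: "\<eta> > 0" "\<And>k. min \<eta> (norm (A (z k)) + norm (z k)) \<le> s k"
    using run by (auto simp: dsg1_run_def dsg1_stepsizes_def)
  have c0: "c 0 \<ge> 0" and par: "\<epsilon> > 0" "\<delta> < 1" and \<alpha>: "\<And>k. \<alpha> k > 0"
    and r: "r \<longlonglongrightarrow> 0"
    and search: "\<And>k. dsg_search f A \<sigma> \<epsilon> \<delta> (y k) (c k) (r k) (x k) (z k)"
    and z_nz: "\<And>k. z k \<noteq> 0" and s_pos: "\<And>k. s k > 0"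
    and y_Suc: "\<And>k. y (Suc k) = y k - s k *\<^sub>R A (z k)"
    and c_Suc: "\<And>k. ereal (c (Suc k)) = ereal (c k) + ereal ((\<alpha> k + 1) * s k) * \<sigma> (z k)"
    using dsg unfolding dsg_run_def by blast+

  define t where "t k = real_of_ereal (\<sigma> (z k))" for k
  have t: "\<sigma> (z k) = ereal (t k)" for k
  proof -
    have "(\<alpha> k + 1) * s k > 0" using \<alpha>[of k] s_pos[of k] by simp
    \<comment> \<open>The updated penalty parameter is finite and the factor positive, which
      excludes an infinite value.\<close>
    then have "\<sigma> (z k) \<noteq> \<infinity>" using c_Suc[of k] by (auto split: if_splits)
    then show ?thesis using \<sigma>_nonneg[of "z k"] unfolding t_def by (cases "\<sigma> (z k)") auto
  qed
  have t_nonneg: "t k \<ge> 0" for k using \<sigma>_nonneg[of "z k"] t[of k] by simp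
  have A_le: "norm (A (z k)) \<le> t k" for k using assms(10)[of "z k"] t[of k] by simp
  have c_Suc': "c (Suc k) = c k + (\<alpha> k + 1) * s k * t k" for k
    using c_Suc[of k] t[of k] by simp

  define D where "D k = (\<Sum>j<k. \<alpha> j * s j * t j)" for k
  have D: "D k + norm (y k - y 0) \<le> c k - c 0" for k
    unfolding D_def
    by (rule deflection_dominates_dual_step[where a = "\<lambda>k. A (z k)"])
      (use y_Suc c_Suc' s_pos A_le in \<open>auto intro: less_imp_le\<close>)
  have term_nonneg: "\<alpha> j * s j * t j \<ge> 0" for j
    using \<alpha>[of j] s_pos[of j] t_nonneg[of j] by simp
  have D_nonneg: "D k \<ge> 0" for k unfolding D_def by (intro sum_nonneg term_nonneg)

  \<comment> \<open>Finite optimal values and near-optimality\<close>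
  have dual_le: "dual_function f A \<sigma> w b \<le> primal_value \<phi>" for w b
    by (rule weak_duality[where f = f and \<phi> = \<phi>]) (simp_all add: A0 \<sigma> assms(5))
  obtain M where M: "primal_value \<phi> = ereal M"
  proof -
    obtain u where "\<phi> u \<noteq> \<infinity>" using assms(2) unfolding proper_def by blast
    moreover have "primal_value \<phi> \<le> \<phi> u" unfolding primal_value_def by (rule INF_lower) simp
    moreover have "primal_value \<phi> \<noteq> -\<infinity>" using dual_le[of yhat chat] assms(19) by auto
    ultimately show ?thesis using that by (cases "primal_value \<phi>") auto
  qed
  obtain qhat where qhat: "dual_function f A \<sigma> yhat chat = ereal qhat"
    using dual_le[of yhat chat] assms(19) M by (cases "dual_function f A \<sigma> yhat chat") auto
  have f_not_minf: "f w \<noteq> -\<infinity>" for w using assms(6) unfolding proper_def by blast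
  have near: "augmented_objective f A \<sigma> (y k) (c k) (x k) (z k)
      \<le> dual_function f A \<sigma> (y k) (c k) + ereal (r k)" for k
    using dsg_search_near_minimizer[OF search par] by (simp add: near_minimizers_def)
  define F where "F k = real_of_ereal (f (x k, z k))" for k
  define v where "v k = real_of_ereal (dual_function f A \<sigma> (y k) (c k))" for k
  have v: "dual_function f A \<sigma> (y k) (c k) = ereal (v k)"
    and F: "f (x k, z k) = ereal (F k)" for k
  proof -
    let ?q = "dual_function f A \<sigma> (y k) (c k)"
    have n: "f (x k, z k) - ereal (A (z k) \<bullet> y k) + ereal (c k * t k) \<le> ?q + ereal (r k)"
      using near[of k] t[of k] unfolding augmented_objective_def by simp
    have "?q \<noteq> \<infinity>" using dual_le[of "y k" "c k"] M by auto
    \<comment> \<open>The value \<open>-\<infinity>\<close> on the right of \<open>n\<close> would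
      force it on the left, but \<open>f\<close> never takes it.\<close>
    moreover have "?q \<noteq> -\<infinity>"
      using n f_not_minf[of "(x k, z k)"] by (cases "f (x k, z k)") auto
    ultimately show q: "?q = ereal (v k)" unfolding v_def by (cases ?q) auto
    show "f (x k, z k) = ereal (F k)"
      using n f_not_minf[of "(x k, z k)"] unfolding q F_def by (cases "f (x k, z k)") auto
  qed
  have v_le: "v k \<le> M" for k using dual_le[of "y k" "c k"] v M by simp
  have near': "F k - A (z k) \<bullet> y k + c k * t k \<le> v k + r k" for k
    using near[of k] t[of k] F[of k] v[of k] unfolding augmented_objective_def by simp
  \<comment> \<open>The pair \<open>(x k, z k)\<close> is tested in the dual function at
    \<open>(y 0, b)\<close> and compared with its near-optimality at \<open>(y k, c k)\<close>.
    Replacing \<open>y k\<close> by \<open>y 0\<close> costs \<open>norm (y k - y 0) * t k\<close>;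
    the growth of \<open>c\<close> pays for this and leaves \<open>D k\<close>. Both
    \<open>b = chat\<close> and \<open>b = c 0\<close> are used.\<close>
  have dual_bound: "q + (c 0 - b + D k) * t k \<le> M + rtilde"
    if q: "dual_function f A \<sigma> (y 0) b = ereal q" for q b k
  proof -
    have "ereal q \<le> augmented_objective f A \<sigma> (y 0) b (x k) (z k)"
      unfolding q[symmetric] dual_function_def
      by (intro INF_lower2[of "x k"] INF_lower2[of "z k"]) auto
    then have "q \<le> F k - A (z k) \<bullet> y 0 + b * t k"
      using t[of k] F[of k] unfolding augmented_objective_def by simp
    moreover have "A (z k) \<bullet> (y k - y 0) \<le> norm (y k - y 0) * t k"
      using norm_cauchy_schwarz[of "A (z k)" "y k - y 0"]
        mult_right_mono[OF A_le[of k] norm_ge_zero[of "y k - y 0"]]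
      by (simp add: mult.commute)
    moreover have "(c 0 + D k) * t k \<le> (c k - norm (y k - y 0)) * t k"
      using D[of k] by (intro mult_right_mono t_nonneg) simp
    ultimately show ?thesis
      using near'[of k] v_le[of k] assms(20)[of k] by (simp add: inner_diff_right algebra_simps)
  qed
  have y0: "y 0 = yhat" using initial_choice by blast
  note bound_hat = dual_bound[OF qhat[folded y0]]

  \<comment> \<open>Bounds on the perturbations and the two regimes of the steps\<close>
  have "qhat \<le> M" using dual_le[of yhat chat] qhat M by simp
  consider (coercive) "coercive \<sigma>" "c 0 > chat"
    | (conditional) K S where "K > 0" "bounded {w. \<sigma> w \<le> ereal K}" "M \<le> S"
        "ereal (c 0) > ereal chat + (ereal S - ereal qhat) / ereal K"
        "ereal (\<alpha> 0 * s 0) > (ereal M - ereal (v 0) + ereal rtilde) / (ereal K * ereal (t 0))"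
    using initial_choice unfolding conditionally_coercive_with_def M qhat v t by auto
  note initial_cases = this
  have c0_chat: "c 0 > chat"
    using initial_cases
  proof cases
    case (conditional K S)
    note K = conditional(1) and S = conditional(3) and c0 = conditional(4)
    have "c 0 > chat + (S - qhat) / K" using c0 K by simp
    moreover have "(S - qhat) / K \<ge> 0" using S \<open>qhat \<le> M\<close> K by simp
    ultimately show ?thesis by linarith
  qed

  \<comment> \<open>Obtained from \<open>bound_hat\<close> by dropping
    \<open>D k \<ge> 0\<close>.\<close>
  define T where "T = (M + rtilde - qhat) / (c 0 - chat)"
  have t_le: "t k \<le> T" for k
  proof -
    have "(c 0 - chat) * t k \<le> (c 0 - chat + D k) * t k"
      using D_nonneg[of k] by (intro mult_right_mono t_nonneg) simp
    then have "(c 0 - chat) * t k \<le> M + rtilde - qhat" using bound_hat[of k] by linarith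
    then show ?thesis unfolding T_def using c0_chat by (simp add: pos_le_divide_eq mult.commute)
  qed
  have "bounded (range z)"
    using initial_cases
  proof cases
    case coercive
    then have "eventually (\<lambda>w. \<sigma> w > ereal T) at_infinity"
      unfolding coercive_def by (auto intro: order_tendstoD)
    then obtain b where b: "\<And>w. norm w \<ge> b \<Longrightarrow> \<sigma> w > ereal T"
      unfolding eventually_at_infinity by blast
    have "norm (z k) \<le> b" for k
    proof (rule ccontr)
      assume "\<not> ?thesis"
      then have "ereal T < ereal (t k)" using b[of "z k"] t[of k] by simp
      then show False using t_le[of k] by simp
    qed
    then show ?thesis unfolding bounded_iff by blast
  next
    case (conditional K S)
    note K = conditional(1,2) and first = conditional(5)
    \<comment> \<open>Needed to clear the denominator in the condition on the first step.\<close>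
    have "t 0 \<noteq> 0"
    proof
      assume "t 0 = 0"
      then have "\<sigma> (z 0) = 0" using t[of 0] by (simp add: zero_ereal_def)
      then have "z 0 \<in> minimizers \<sigma>" using \<sigma>_nonneg by (simp add: minimizers_def)
      then show False using \<sigma>(2) z_nz[of 0] by simp
    qed
    then have t0: "t 0 > 0" using t_nonneg[of 0] by simp
    have "\<alpha> 0 * s 0 > (M - v 0 + rtilde) / (K * t 0)" using first K(1) t0 by simp
    then have "M - v 0 + rtilde < \<alpha> 0 * s 0 * (K * t 0)"
      using K(1) t0 by (subst (asm) pos_divide_less_eq) auto
    then have big: "M - v 0 + rtilde < (\<alpha> 0 * s 0 * t 0) * K" by (simp add: ac_simps)
    \<comment> \<open>From \<open>k = 1\<close> on, \<open>D k\<close> contains the first term, and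
      \<open>dual_bound\<close> at \<open>b = c 0\<close> has \<open>D k\<close> as its only
      coefficient. The point \<open>z 0\<close> is adjoined to the level set separately.\<close>
    have "\<sigma> (z k) \<le> ereal K" if "k > 0" for k
    proof -
      have "\<alpha> 0 * s 0 * t 0 \<le> D k"
        unfolding D_def by (rule member_le_sum) (use that term_nonneg in auto)
      then have "(\<alpha> 0 * s 0 * t 0) * t k \<le> D k * t k"
        by (intro mult_right_mono t_nonneg)
      then have "(\<alpha> 0 * s 0 * t 0) * t k < (\<alpha> 0 * s 0 * t 0) * K"
        using dual_bound[OF v[of 0], of k] big by simp
      then have "t k < K"
        using mult_less_cancel_left_pos[of "\<alpha> 0 * s 0 * t 0"] \<alpha>[of 0] s_pos[of 0] t0 by simp
      then show ?thesis using t[of k] by simp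
    qed
    then have "z k \<in> insert (z 0) {w. \<sigma> w \<le> ereal K}" for k by (cases "k = 0") auto
    then have "range z \<subseteq> insert (z 0) {w. \<sigma> w \<le> ereal K}" by blast
    then show ?thesis using K(2) bounded_subset bounded_insert by blast
  qed
  then obtain R where R: "\<And>k. norm (z k) \<le> R" unfolding bounded_iff by blast

  \<comment> \<open>The multipliers \<open>y\<close> converge in the first case; in the second the penalty parameter
    outgrows them.\<close>
  have steps: "summable (\<lambda>k. s k * t k) \<or> t \<longlonglongrightarrow> 0"
  proof (cases "bounded (range D)")
    case True
    then obtain b where b: "\<And>k. D k \<le> b" unfolding bounded_iff by (auto simp: abs_le_iff)
    have "summable (\<lambda>k. s k * t k)"
    proof (rule summableI_nonneg_bounded)
      show "0 \<le> s k * t k" for k using s_pos[of k] t_nonneg[of k] by simp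
      fix k
      \<comment> \<open>The lower bound on \<open>\<alpha>\<close> strips off the weights, so
        boundedness of \<open>D\<close> passes to the partial sums of
        \<open>s j * t j\<close>.\<close>
      have "\<alpha>bar * (\<Sum>j<k. s j * t j) \<le> D k"
        unfolding D_def sum_distrib_left
      proof (rule sum_mono)
        fix j
        have "\<alpha>bar * (s j * t j) \<le> \<alpha> j * (s j * t j)"
          using assms(17) s_pos[of j] t_nonneg[of j] by (intro mult_right_mono) auto
        then show "\<alpha>bar * (s j * t j) \<le> \<alpha> j * s j * t j" by (simp add: ac_simps)
      qed
      then have "\<alpha>bar * (\<Sum>j<k. s j * t j) \<le> b" using b[of k] by linarith
      then show "(\<Sum>j<k. s j * t j) \<le> b / \<alpha>bar"
        using assms(16) by (simp add: pos_le_divide_eq mult.commute)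
    qed
    then show ?thesis ..
  next
    case False
    have mono: "mono D" unfolding D_def
      by (intro monoI sum_mono2) (use term_nonneg in auto)
    have top: "filterlim D at_top sequentially"
      unfolding filterlim_at_top
    proof
      fix b
      have "\<exists>n. D n \<ge> b"
      proof (rule ccontr)
        assume "\<not> ?thesis"
        then have "norm (D n) \<le> b" for n using D_nonneg[of n] by (simp add: not_le less_imp_le)
        then show False using False unfolding bounded_iff by blast
      qed
      then obtain n where "D n \<ge> b" by blast
      then show "\<forall>\<^sub>F k in sequentially. b \<le> D k"
        using order_trans[OF _ monoD[OF mono]] unfolding eventually_sequentially by blast
    qed
    \<comment> \<open>\<open>D k * t k\<close> stays bounded while \<open>D k\<close> grows without
      bound.\<close>
    have "t \<longlonglongrightarrow> 0"
    proof (rule tendsto_sandwich)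
      show "\<forall>\<^sub>F k in sequentially. 0 \<le> t k" using t_nonneg by simp
      show "(\<lambda>k. (M + rtilde - qhat) / D k) \<longlonglongrightarrow> 0"
        by (rule real_tendsto_divide_at_top[OF tendsto_const top])
      have "\<forall>\<^sub>F k in sequentially. D k > 0" using top by (simp add: filterlim_at_top_dense)
      then show "\<forall>\<^sub>F k in sequentially. t k \<le> (M + rtilde - qhat) / D k"
      proof eventually_elim
        case (elim k)
        have "D k * t k \<le> (c 0 - chat + D k) * t k"
          using c0_chat by (intro mult_right_mono t_nonneg) simp
        then have "D k * t k \<le> M + rtilde - qhat" using bound_hat[of k] by linarith
        then show ?case using elim by (simp add: pos_le_divide_eq mult.commute)
      qed
    qed simp
    then show ?thesis ..
  qed

  \<comment> \<open>Weak convergence of the perturbations to zero\<close>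
  have z_weak: "limitin weak_topology z 0 sequentially"
  proof (rule unique_minimizer_weakly_attracts[OF \<sigma> R])
    fix \<rho> e :: real assume \<rho>: "\<rho> > 0" and e: "e > 0"
    from steps have "\<forall>\<^sub>F k in sequentially. norm (z k) \<ge> \<rho> \<longrightarrow> t k \<le> e"
    proof
      assume "summable (\<lambda>k. s k * t k)"
      then have "(\<lambda>k. s k * t k) \<longlonglongrightarrow> 0" by (rule summable_LIMSEQ_zero)
      \<comment> \<open>Where \<open>norm (z k) \<ge> \<rho>\<close>, the stepsize is at least
        \<open>min \<eta> \<rho>\<close>; cancelling that factor leaves
        \<open>t k < e\<close>.\<close>
      then have "\<forall>\<^sub>F k in sequentially. s k * t k < min \<eta> \<rho> * e"
        by (rule order_tendstoD) (use step(1) \<rho> e in simp)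
      then show ?thesis
      proof (eventually_elim, intro impI)
        fix k assume k: "s k * t k < min \<eta> \<rho> * e" and "\<rho> \<le> norm (z k)"
        then have "min \<eta> \<rho> \<le> s k"
          using step(2)[of k] norm_ge_zero[of "A (z k)"] by linarith
        then have "min \<eta> \<rho> * t k \<le> s k * t k" by (intro mult_right_mono t_nonneg)
        with k have "min \<eta> \<rho> * t k < min \<eta> \<rho> * e" by linarith
        then show "t k \<le> e" using step(1) \<rho> by (simp add: mult_less_cancel_left_pos)
      qed
    next
      assume "t \<longlonglongrightarrow> 0"
      then have "\<forall>\<^sub>F k in sequentially. t k < e" using e by (rule order_tendstoD)
      then show ?thesis by eventually_elim simp
    qed
    then show "\<forall>\<^sub>F k in sequentially. norm (z k) \<ge> \<rho> \<longrightarrow> \<sigma> (z k) \<le> ereal e"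
      using t by simp
  qed

  \<comment> \<open>Asymptotic sign of coupling minus penalty\<close>
  have penalty: "\<forall>\<^sub>F k in sequentially. A (z k) \<bullet> y k - c k * t k < e" if e: "e > 0" for e
    using steps
  proof
    assume "t \<longlonglongrightarrow> 0"
    then have "(\<lambda>k. t k * norm (y 0)) \<longlonglongrightarrow> 0" by (rule tendsto_mult_left_zero)
    then have "\<forall>\<^sub>F k in sequentially. t k * norm (y 0) < e" using e by (rule order_tendstoD)
    then show ?thesis
    proof eventually_elim
      case (elim k)
      have "norm (y k) \<le> norm (y 0) + norm (y k - y 0)"
        using norm_triangle_ineq[of "y 0" "y k - y 0"] by simp
      \<comment> \<open>The penalty \<open>c k * t k\<close> will cancel the growing part of the
        coupling, leaving only \<open>t k * norm (y 0)\<close>.\<close>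
      then have "norm (y k) \<le> norm (y 0) + c k" using D[of k] D_nonneg[of k] c0 by linarith
      then have "t k * norm (y k) \<le> t k * (norm (y 0) + c k)"
        by (intro mult_left_mono t_nonneg)
      moreover have "A (z k) \<bullet> y k \<le> t k * norm (y k)"
        using norm_cauchy_schwarz[of "A (z k)" "y k"]
          mult_right_mono[OF A_le[of k] norm_ge_zero[of "y k"]] by linarith
      ultimately show ?case using elim by (simp add: algebra_simps)
    qed
  next
    assume sum: "summable (\<lambda>k. s k * t k)"
    \<comment> \<open>Norm convergence of \<open>y\<close> lets \<open>y k\<close> be replaced by a
      fixed \<open>ybar\<close> at the vanishing cost \<open>T * norm (y k - ybar)\<close>; weak
      upper semicontinuity then applies to the fixed vector, with value \<open>0\<close> at the weak
      limit since \<open>A 0 = 0\<close>.\<close>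
    have "summable (\<lambda>k. s k *\<^sub>R A (z k))"
    proof (rule summable_comparison_test[OF _ sum], intro exI allI impI)
      show "norm (s k *\<^sub>R A (z k)) \<le> s k * t k" for k
        using A_le[of k] s_pos[of k] by (simp add: mult_left_mono)
    qed
    then have "(\<lambda>k. y 0 - (\<Sum>j<k. s j *\<^sub>R A (z j))) \<longlonglongrightarrow> y 0 - (\<Sum>j. s j *\<^sub>R A (z j))"
      by (intro tendsto_intros summable_LIMSEQ)
    moreover have "y k = y 0 - (\<Sum>j<k. s j *\<^sub>R A (z j))" for k
      by (induction k) (simp_all add: y_Suc algebra_simps)
    ultimately obtain ybar where ybar: "y \<longlonglongrightarrow> ybar" by (metis (no_types, lifting) ext)
    have "(\<lambda>k. T * norm (y k - ybar)) \<longlonglongrightarrow> T * norm (ybar - ybar)"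
      by (intro tendsto_intros ybar)
    then have "\<forall>\<^sub>F k in sequentially. T * norm (y k - ybar) < e / 2"
      by (rule order_tendstoD) (use e in simp)
    moreover have "\<forall>\<^sub>F k in sequentially. ereal (A (z k) \<bullet> ybar) < ereal (e / 2)"
      by (rule w_usc_eventually_less[OF assms(11) z_weak]) (use A0 e in simp)
    ultimately show ?thesis
    proof eventually_elim
      case (elim k)
      have "A (z k) \<bullet> (y k - ybar) \<le> T * norm (y k - ybar)"
        using norm_cauchy_schwarz[of "A (z k)" "y k - ybar"]
          mult_right_mono[OF order_trans[OF A_le t_le] norm_ge_zero[of "y k - ybar"], of k]
        by linarith
      moreover have "c k \<ge> 0"
        using D[of k] D_nonneg[of k] c0 norm_ge_zero[of "y k - y 0"] by linarith
      then have "c k * t k \<ge> 0" using t_nonneg[of k] by simp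
      moreover have "A (z k) \<bullet> ybar < e / 2" using elim(2) by simp
      ultimately show ?case using elim(1) by (simp add: inner_diff_right)
    qed
  qed

  \<comment> \<open>Convergence of the primal iterates and of the dual values\<close>
  have approx: "\<forall>\<^sub>F k in sequentially. f (x k, z k) \<le> ereal (v k + e)" if e: "e > 0" for e
  proof -
    have "\<forall>\<^sub>F k in sequentially. r k < e / 2"
      using r by (rule order_tendstoD) (use e in simp)
    moreover have "\<forall>\<^sub>F k in sequentially. A (z k) \<bullet> y k - c k * t k < e / 2"
      using penalty[of "e / 2"] e by simp
    ultimately show ?thesis
    proof eventually_elim
      case (elim k)
      then have "F k \<le> v k + e" using near'[of k] by linarith
      then show ?case using F[of k] by simp
    qed
  qed
  note concl = perturbed_minimizing_sequence[where f = f and \<phi> = \<phi>, OF assms(5,7,8) M z_weak v_le approx]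
  have "(\<lambda>k. ereal (v k)) \<longlonglongrightarrow> ereal M" using concl(3) by simp
  then show ?thesis using concl(1,2) v M by simp
qed

end
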